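(* Let $d$ be a positive integer and let $f\colon\mathbb{N}^d\to\mathbb{N}$ be any $d$-tupling function. A function $\sigma\colon\mathbb{N}^d\to\mathbb{N}$ is a shell numbering for $f$ if and only if, for all points $\mathbf{x}\in\mathbb{N}^d$, $$\bigl\lvert U_\sigma^{<n}\bigr\rvert\leq f(\mathbf{x})<\bigl\lvert U_\sigma^{<n+1}\bigr\rvert,\qquad\text{where } n=\sigma(\mathbf{x}).$$
   Context: $\mathbb{N}$ denotes the set of non-negative integers. A $d$-tupling function for $\mathbb{N}$ is a bijection from $\mathbb{N}^d$ to $\mathbb{N}$. Given a $d$-tupling function $f$, a function $\sigma\colon\mathbb{N}^d\to\mathbb{N}$ is a shell numbering for $f$ if and only if for all $\mathbf{x},\mathbf{y}\in\mathbb{N}^d$, $\sigma(\mathbf{x})<\sigma(\mathbf{y})$ implies $f(\mathbf{x})<f(\mathbf{y})$. For a function $\sigma\colon\mathbb{N}^d\to\mathbb{N}$ and $n\in\mathbb{N}$, $U_\sigma^{<n}$ denotes the set of all $\mathbf{y}\in\mathbb{N}^d$ with $\sigma(\mathbf{y})<n$. Convention for infinite cardinalities: if $U_\sigma^{<n}$ is infinite then $\lvert U_\sigma^{<n}\rvert\le i$ is false for every $i\in\mathbb{N}$; if $U_\sigma^{<n+1}$ is infinite then $i<\lvert U_\sigma^{<n+1}\rvert$ is true for every $i\in\mathbb{N}$. *)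

theory Defs
  imports "HOL-Analysis.Finite_Cartesian_Product" "HOL-Library.Extended_Nat"
begin

text \<open>
  The set of \<open>d\<close>-tuples of naturals is rendered as the type \<^typ>\<open>nat ^ 'd\<close> with \<open>d = CARD('d)\<close>.
  Since types are nonempty, \<open>d\<close> ranges over exactly the positive integers.
\<close>

definition tupling_function :: "(nat ^ 'd \<Rightarrow> nat) \<Rightarrow> bool" where
  "tupling_function f \<longleftrightarrow> bij f"

definition shell_numbering :: "(nat ^ 'd \<Rightarrow> nat) \<Rightarrow> (nat ^ 'd \<Rightarrow> nat) \<Rightarrow> bool" where
  "shell_numbering f \<sigma> \<longleftrightarrow> (\<forall>x y. \<sigma> x < \<sigma> y \<longrightarrow> f x < f y)"

definition sublevel :: "(nat ^ 'd \<Rightarrow> nat) \<Rightarrow> nat \<Rightarrow> (nat ^ 'd) set" where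
  "sublevel \<sigma> n = {y. \<sigma> y < n}"

text \<open>
  \<^const>\<open>card\<close> is \<open>0\<close> on infinite sets, so cardinalities are taken in \<^typ>\<open>enat\<close>: an infinite
  set has cardinality \<open>\<infinity>\<close>, which is above every natural number.
\<close>

definition ecard :: "'a set \<Rightarrow> enat" where
  "ecard A = (if finite A then enat (card A) else \<infinity>)"

end

theory Submission imports Defs begin

text \<open>As \<open>f\<close> is a bijection, a sublevel set of \<sigma> has the same size as its
  image under \<open>f\<close>, a set of naturals that can be compared with initial segments. For a
  shell numbering, the image of the points in shells before that of \<open>x\<close> lies in
  \<open>{..<f x}\<close>, and adding the shell of \<open>x\<close> itself makes the image cover
  \<open>{..f x}\<close>; these inclusions are the two bounds. Conversely, if \<open>x\<close> lies
  in an earlier shell than \<open>y\<close>, the upper bound at \<open>x\<close> and the lower bound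
  at \<open>y\<close> are linked by monotonicity of cardinality.\<close>

lemma ecard_mono: "A \<subseteq> B \<Longrightarrow> ecard A \<le> ecard B"
  by (auto simp: ecard_def card_mono dest: finite_subset)

lemma ecard_image: "inj_on g A \<Longrightarrow> ecard (g ` A) = ecard A"
  by (simp add: ecard_def card_image finite_image_iff)

theorem theorem4:
  fixes f :: "nat ^ 'd::finite \<Rightarrow> nat" and \<sigma> :: "nat ^ 'd \<Rightarrow> nat"
  assumes "tupling_function f"
  shows "shell_numbering f \<sigma> \<longleftrightarrow>
    (\<forall>x. ecard (sublevel \<sigma> (\<sigma> x)) \<le> enat (f x) \<and> enat (f x) < ecard (sublevel \<sigma> (\<sigma> x + 1)))"
proof
  have "bij f"
    using assms by (simp add: tupling_function_def)
  then have ecard_f: "ecard (f ` A) = ecard A" for A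
    by (meson bij_is_inj ecard_image inj_on_subset subset_UNIV)
  assume shell: "shell_numbering f \<sigma>"
  show "\<forall>x. ecard (sublevel \<sigma> (\<sigma> x)) \<le> enat (f x) \<and> enat (f x) < ecard (sublevel \<sigma> (\<sigma> x + 1))"
  proof (intro allI conjI)
    fix x
    have "f ` sublevel \<sigma> (\<sigma> x) \<subseteq> {..<f x}"
      using shell by (auto simp: shell_numbering_def sublevel_def)
    from ecard_mono[OF this] show "ecard (sublevel \<sigma> (\<sigma> x)) \<le> enat (f x)"
      unfolding ecard_f by (simp add: ecard_def)
    \<comment> \<open>The closed segment has \<open>Suc (f x)\<close> elements, which is what makes
      the upper bound strict.\<close>
    have "{..f x} \<subseteq> f ` sublevel \<sigma> (\<sigma> x + 1)"
    proof
      fix k assume "k \<in> {..f x}"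
      moreover obtain y where "k = f y"
        using \<open>bij f\<close> by (meson bij_pointE)
      \<comment> \<open>Contraposition: a later shell would force \<open>f x < f y\<close>, against
        \<open>f y \<le> f x\<close>.\<close>
      ultimately have "\<not> \<sigma> x < \<sigma> y"
        using shell by (auto simp: shell_numbering_def not_less[symmetric])
      then show "k \<in> f ` sublevel \<sigma> (\<sigma> x + 1)"
        using \<open>k = f y\<close> by (auto simp: sublevel_def)
    qed
    from ecard_mono[OF this] have "enat (Suc (f x)) \<le> ecard (sublevel \<sigma> (\<sigma> x + 1))"
      unfolding ecard_f by (simp add: ecard_def)
    then show "enat (f x) < ecard (sublevel \<sigma> (\<sigma> x + 1))"
      by (simp add: Suc_ile_eq)
  qed
next
  assume bounds: "\<forall>x. ecard (sublevel \<sigma> (\<sigma> x)) \<le> enat (f x) \<and> enat (f x) < ecard (sublevel \<sigma> (\<sigma> x + 1))"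
  show "shell_numbering f \<sigma>"
    unfolding shell_numbering_def
  proof (intro allI impI)
    fix x y assume "\<sigma> x < \<sigma> y"
    have "enat (f x) < ecard (sublevel \<sigma> (\<sigma> x + 1))"
      using bounds by blast
    \<comment> \<open>Shell numbers are integers, so \<open>\<sigma> x + 1 \<le> \<sigma> y\<close>
      and the sublevel sets are nested.\<close>
    also have "\<dots> \<le> ecard (sublevel \<sigma> (\<sigma> y))"
      using \<open>\<sigma> x < \<sigma> y\<close> by (intro ecard_mono) (auto simp: sublevel_def)
    also have "\<dots> \<le> enat (f y)"
      using bounds by blast
    finally show "f x < f y"
      by simp
  qed
qed

end
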